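(* Let $L$ be a finite-dimensional perfect diassociative algebra and let $0\to R\to F\to L\to 0$ be a free presentation of $L$. Then $F'/(F\lozenge R+R\lozenge F)$ is a cover of $L$.
   Context: All algebras are over a fixed field $\mathbb{F}$. A diassociative algebra is a vector space $L$ with two bilinear associative products $\dashv,\vdash$ satisfying, for all $x,y,z\in L$: $x\dashv(y\dashv z)=x\dashv(y\vdash z)$, $(x\vdash y)\dashv z=x\vdash(y\dashv z)$, $(x\dashv y)\vdash z=(x\vdash y)\vdash z$. Homomorphisms are linear maps preserving both products. For subalgebras $S,T$ of $L$, $S\lozenge T=S\dashv T+S\vdash T$ (linear span of all products $s\dashv t$ and $s\vdash t$). $L'=L\lozenge L$, and $L$ is perfect if $L=L'$. The center $Z(L)$ is the set of $z\in L$ with $z\dashv x=x\dashv z=z\vdash x=x\vdash z=0$ for all $x\in L$. A free presentation of $L$ is a short exact sequence $0\to R\to F\to L\to 0$ of diassociative algebras with $F$ a free diassociative algebra and $R\to F$ the inclusion of the kernel; $F\lozenge R+R\lozenge F$ is an ideal of $F$. A defining pair $(K,M)$ of $L$ is a pair of diassociative algebras with $M\subseteq Z(K)\cap K'$ and $K/M\cong L$. It is a maximal defining pair if $\dim K$ is maximal among all defining pairs of $L$; in that case $K$ is called a cover of $L$ and $M$ is called the multiplier of $L$, denoted $M(L)$. *)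

theory Defs
  imports "Jordan_Normal_Form.Missing_VectorSpace" "HOL-Algebra.QuotRing" "HOL-Library.Equipollence"
begin

section \<open>Diassociative algebras\<close>

text \<open>As in every module record of HOL-Algebra, the fields \<open>mult\<close> and \<open>one\<close> are
  present but carry no information; the two products are \<open>lprod\<close> and \<open>rprod\<close>.\<close>

record ('f, 'a) diass = "('f, 'a) module" +
  lprod :: "'a \<Rightarrow> 'a \<Rightarrow> 'a" (infixl \<open>\<stileturn>\<index>\<close> 70)
  rprod :: "'a \<Rightarrow> 'a \<Rightarrow> 'a" (infixl \<open>\<turnstile>\<index>\<close> 70)

locale diassociative_algebra = vectorspace k A
  for k :: "('f, 'r) ring_scheme" and A :: "('f, 'a, 'm) diass_scheme" (structure) +
  assumes lprod_closed: "\<lbrakk>x \<in> carrier A; y \<in> carrier A\<rbrakk> \<Longrightarrow> x \<stileturn> y \<in> carrier A"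
    and rprod_closed: "\<lbrakk>x \<in> carrier A; y \<in> carrier A\<rbrakk> \<Longrightarrow> x \<turnstile> y \<in> carrier A"
    and lprod_add_left: "\<lbrakk>x \<in> carrier A; y \<in> carrier A; z \<in> carrier A\<rbrakk>
          \<Longrightarrow> (x \<oplus>\<^bsub>A\<^esub> y) \<stileturn> z = x \<stileturn> z \<oplus>\<^bsub>A\<^esub> y \<stileturn> z"
    and lprod_add_right: "\<lbrakk>x \<in> carrier A; y \<in> carrier A; z \<in> carrier A\<rbrakk>
          \<Longrightarrow> x \<stileturn> (y \<oplus>\<^bsub>A\<^esub> z) = x \<stileturn> y \<oplus>\<^bsub>A\<^esub> x \<stileturn> z"
    and rprod_add_left: "\<lbrakk>x \<in> carrier A; y \<in> carrier A; z \<in> carrier A\<rbrakk>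
          \<Longrightarrow> (x \<oplus>\<^bsub>A\<^esub> y) \<turnstile> z = x \<turnstile> z \<oplus>\<^bsub>A\<^esub> y \<turnstile> z"
    and rprod_add_right: "\<lbrakk>x \<in> carrier A; y \<in> carrier A; z \<in> carrier A\<rbrakk>
          \<Longrightarrow> x \<turnstile> (y \<oplus>\<^bsub>A\<^esub> z) = x \<turnstile> y \<oplus>\<^bsub>A\<^esub> x \<turnstile> z"
    and lprod_smult_left: "\<lbrakk>c \<in> carrier k; x \<in> carrier A; y \<in> carrier A\<rbrakk>
          \<Longrightarrow> (c \<odot>\<^bsub>A\<^esub> x) \<stileturn> y = c \<odot>\<^bsub>A\<^esub> (x \<stileturn> y)"
    and lprod_smult_right: "\<lbrakk>c \<in> carrier k; x \<in> carrier A; y \<in> carrier A\<rbrakk>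
          \<Longrightarrow> x \<stileturn> (c \<odot>\<^bsub>A\<^esub> y) = c \<odot>\<^bsub>A\<^esub> (x \<stileturn> y)"
    and rprod_smult_left: "\<lbrakk>c \<in> carrier k; x \<in> carrier A; y \<in> carrier A\<rbrakk>
          \<Longrightarrow> (c \<odot>\<^bsub>A\<^esub> x) \<turnstile> y = c \<odot>\<^bsub>A\<^esub> (x \<turnstile> y)"
    and rprod_smult_right: "\<lbrakk>c \<in> carrier k; x \<in> carrier A; y \<in> carrier A\<rbrakk>
          \<Longrightarrow> x \<turnstile> (c \<odot>\<^bsub>A\<^esub> y) = c \<odot>\<^bsub>A\<^esub> (x \<turnstile> y)"
    and lprod_assoc: "\<lbrakk>x \<in> carrier A; y \<in> carrier A; z \<in> carrier A\<rbrakk>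
          \<Longrightarrow> (x \<stileturn> y) \<stileturn> z = x \<stileturn> (y \<stileturn> z)"
    and rprod_assoc: "\<lbrakk>x \<in> carrier A; y \<in> carrier A; z \<in> carrier A\<rbrakk>
          \<Longrightarrow> (x \<turnstile> y) \<turnstile> z = x \<turnstile> (y \<turnstile> z)"
    and diass_left: "\<lbrakk>x \<in> carrier A; y \<in> carrier A; z \<in> carrier A\<rbrakk>
          \<Longrightarrow> x \<stileturn> (y \<stileturn> z) = x \<stileturn> (y \<turnstile> z)"
    and diass_mid: "\<lbrakk>x \<in> carrier A; y \<in> carrier A; z \<in> carrier A\<rbrakk>
          \<Longrightarrow> (x \<turnstile> y) \<stileturn> z = x \<turnstile> (y \<stileturn> z)"
    and diass_right: "\<lbrakk>x \<in> carrier A; y \<in> carrier A; z \<in> carrier A\<rbrakk>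
          \<Longrightarrow> (x \<stileturn> y) \<turnstile> z = (x \<turnstile> y) \<turnstile> z"

definition diass_hom ::
  "('f, 'r) ring_scheme \<Rightarrow> ('f, 'a, 'm) diass_scheme \<Rightarrow> ('f, 'b, 'n) diass_scheme \<Rightarrow> ('a \<Rightarrow> 'b) set"
  where "diass_hom k A B = {f \<in> module_hom k A B. \<forall>x\<in>carrier A. \<forall>y\<in>carrier A.
           f (x \<stileturn>\<^bsub>A\<^esub> y) = f x \<stileturn>\<^bsub>B\<^esub> f y \<and> f (x \<turnstile>\<^bsub>A\<^esub> y) = f x \<turnstile>\<^bsub>B\<^esub> f y}"

definition diass_isomorphic ::
  "('f, 'r) ring_scheme \<Rightarrow> ('f, 'a, 'm) diass_scheme \<Rightarrow> ('f, 'b, 'n) diass_scheme \<Rightarrow> bool"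
  where "diass_isomorphic k A B \<longleftrightarrow> (\<exists>f\<in>diass_hom k A B. bij_betw f (carrier A) (carrier B))"

definition diass_subalgebra ::
  "('f, 'r) ring_scheme \<Rightarrow> 'a set \<Rightarrow> ('f, 'a, 'm) diass_scheme \<Rightarrow> bool"
  where "diass_subalgebra k S A \<longleftrightarrow> VectorSpace.subspace k S A \<and>
           (\<forall>x\<in>S. \<forall>y\<in>S. x \<stileturn>\<^bsub>A\<^esub> y \<in> S \<and> x \<turnstile>\<^bsub>A\<^esub> y \<in> S)"

definition diamond ::
  "('f, 'r) ring_scheme \<Rightarrow> ('f, 'a, 'm) diass_scheme \<Rightarrow> 'a set \<Rightarrow> 'a set \<Rightarrow> 'a set"
  where "diamond k A S T =
           module.span k A ({s \<stileturn>\<^bsub>A\<^esub> t |s t. s \<in> S \<and> t \<in> T} \<union> {s \<turnstile>\<^bsub>A\<^esub> t |s t. s \<in> S \<and> t \<in> T})"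

definition derived :: "('f, 'r) ring_scheme \<Rightarrow> ('f, 'a, 'm) diass_scheme \<Rightarrow> 'a set"
  where "derived k A = diamond k A (carrier A) (carrier A)"

definition perfect :: "('f, 'r) ring_scheme \<Rightarrow> ('f, 'a, 'm) diass_scheme \<Rightarrow> bool"
  where "perfect k A \<longleftrightarrow> carrier A = derived k A"

definition diass_center :: "('f, 'a, 'm) diass_scheme \<Rightarrow> 'a set"
  where "diass_center A = {z \<in> carrier A. \<forall>x\<in>carrier A.
           z \<stileturn>\<^bsub>A\<^esub> x = \<zero>\<^bsub>A\<^esub> \<and> x \<stileturn>\<^bsub>A\<^esub> z = \<zero>\<^bsub>A\<^esub> \<and> z \<turnstile>\<^bsub>A\<^esub> x = \<zero>\<^bsub>A\<^esub> \<and> x \<turnstile>\<^bsub>A\<^esub> z = \<zero>\<^bsub>A\<^esub>}"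

text \<open>The algebra of cosets of an ideal \<open>I\<close>, built like \<^const>\<open>FactRing\<close>: a product of two
  cosets is the coset of the product of any two representatives.\<close>

definition diass_quotient ::
  "('f, 'a, 'm) diass_scheme \<Rightarrow> 'a set \<Rightarrow> ('f, 'a set) diass" (infixl \<open>'/\<^sub>d\<close> 65)
  where "A /\<^sub>d I =
    \<lparr>carrier = a_rcosets\<^bsub>A\<^esub> I, mult = undefined, one = undefined,
     zero = I, add = set_add A,
     smult = (\<lambda>c C. \<Union>x\<in>C. I +>\<^bsub>A\<^esub> (c \<odot>\<^bsub>A\<^esub> x)),
     lprod = (\<lambda>C D. \<Union>x\<in>C. \<Union>y\<in>D. I +>\<^bsub>A\<^esub> (x \<stileturn>\<^bsub>A\<^esub> y)),
     rprod = (\<lambda>C D. \<Union>x\<in>C. \<Union>y\<in>D. I +>\<^bsub>A\<^esub> (x \<turnstile>\<^bsub>A\<^esub> y))\<rparr>"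


section \<open>Free diassociative algebras and free presentations\<close>

datatype ('f, 'x) diass_term =
    Gen 'x
  | Zero
  | Add "('f, 'x) diass_term" "('f, 'x) diass_term"
  | Smult 'f "('f, 'x) diass_term"
  | LProd "('f, 'x) diass_term" "('f, 'x) diass_term"
  | RProd "('f, 'x) diass_term" "('f, 'x) diass_term"

text \<open>The universal property of a free algebra on \<open>X\<close>. HOL cannot quantify over the type of the
  test algebra \<open>A\<close>, so \<open>A\<close> ranges over the algebras whose elements are sets of terms in
  generators from the type of \<open>F\<close>. This is no restriction: theorem \<open>free_diass_universal\<close>
  below derives the universal property (existence and uniqueness) for test algebras over an arbitrary type.\<close>

definition free_diass_on :: "('f, 'r) ring_scheme \<Rightarrow> ('f, 'a) diass \<Rightarrow> 'a set \<Rightarrow> bool"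
  where "free_diass_on k F X \<longleftrightarrow> diassociative_algebra k F \<and> X \<subseteq> carrier F \<and>
    (\<forall>(A :: ('f, ('f, 'a) diass_term set) diass) g.
       diassociative_algebra k A \<longrightarrow> g \<in> X \<rightarrow> carrier A \<longrightarrow>
       (\<exists>!h. h \<in> diass_hom k F A \<inter> extensional (carrier F) \<and> (\<forall>x\<in>X. h x = g x)))"

definition free_diass :: "('f, 'r) ring_scheme \<Rightarrow> ('f, 'a) diass \<Rightarrow> bool"
  where "free_diass k F \<longleftrightarrow> (\<exists>X. free_diass_on k F X)"

text \<open>The exact sequence \<open>0 \<rightarrow> R \<rightarrow> F \<rightarrow> L \<rightarrow> 0\<close> with projection \<open>p\<close>.\<close>

definition free_presentation ::
  "('f, 'r) ring_scheme \<Rightarrow> 'a set \<Rightarrow> ('f, 'a) diass \<Rightarrow> ('a \<Rightarrow> 'l) \<Rightarrow> ('f, 'l) diass \<Rightarrow> bool"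
  where "free_presentation k R F p L \<longleftrightarrow> free_diass k F \<and> diassociative_algebra k L \<and>
           p \<in> diass_hom k F L \<and> p ` carrier F = carrier L \<and> R = a_kernel F L p"


section \<open>Defining pairs and covers\<close>

definition defining_pair ::
  "('f, 'r) ring_scheme \<Rightarrow> ('f, 'l) diass \<Rightarrow> ('f, 'a) diass \<Rightarrow> 'a set \<Rightarrow> bool"
  where "defining_pair k L K M \<longleftrightarrow> diassociative_algebra k K \<and> diass_subalgebra k M K \<and>
           M \<subseteq> diass_center K \<inter> derived k K \<and> diass_isomorphic k (K /\<^sub>d M) L"

text \<open>Comparison of dimensions as cardinals. The library's \<^const>\<open>vectorspace.dim\<close> is a natural
  number and meaningless for infinite-dimensional spaces.\<close>

definition dim_le ::
  "('f, 'r) ring_scheme \<Rightarrow> ('f, 'a, 'm) module_scheme \<Rightarrow> ('f, 'b, 'n) module_scheme \<Rightarrow> bool"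
  where "dim_le k V W \<longleftrightarrow>
           (\<exists>B C. vectorspace.basis k V B \<and> vectorspace.basis k W C \<and> B \<lesssim> C)"

text \<open>The argument \<open>TYPE('b)\<close> is the type over which the competing defining pairs range.
  A claim with a free \<open>'b\<close> asserts maximality among all defining pairs.\<close>

definition maximal_defining_pair ::
  "'b itself \<Rightarrow> ('f, 'r) ring_scheme \<Rightarrow> ('f, 'l) diass \<Rightarrow> ('f, 'a) diass \<Rightarrow> 'a set \<Rightarrow> bool"
  where "maximal_defining_pair _ k L K M \<longleftrightarrow> defining_pair k L K M \<and>
           (\<forall>(K' :: ('f, 'b) diass) M'. defining_pair k L K' M' \<longrightarrow> dim_le k K' K)"

definition diass_cover ::
  "'b itself \<Rightarrow> ('f, 'r) ring_scheme \<Rightarrow> ('f, 'l) diass \<Rightarrow> ('f, 'a) diass \<Rightarrow> bool"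
  where "diass_cover T k L K \<longleftrightarrow> (\<exists>M. maximal_defining_pair T k L K M)"


section \<open>The universal property over all types\<close>

lemma diass_homD:
  assumes "f \<in> diass_hom k A B"
  shows "x \<in> carrier A \<Longrightarrow> f x \<in> carrier B"
    and "\<lbrakk>x \<in> carrier A; y \<in> carrier A\<rbrakk> \<Longrightarrow> f (x \<oplus>\<^bsub>A\<^esub> y) = f x \<oplus>\<^bsub>B\<^esub> f y"
    and "\<lbrakk>c \<in> carrier k; x \<in> carrier A\<rbrakk> \<Longrightarrow> f (c \<odot>\<^bsub>A\<^esub> x) = c \<odot>\<^bsub>B\<^esub> f x"
    and "\<lbrakk>x \<in> carrier A; y \<in> carrier A\<rbrakk> \<Longrightarrow> f (x \<stileturn>\<^bsub>A\<^esub> y) = f x \<stileturn>\<^bsub>B\<^esub> f y"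
    and "\<lbrakk>x \<in> carrier A; y \<in> carrier A\<rbrakk> \<Longrightarrow> f (x \<turnstile>\<^bsub>A\<^esub> y) = f x \<turnstile>\<^bsub>B\<^esub> f y"
  using assms by (auto simp: diass_hom_def module_hom_def)

lemma diass_homI:
  assumes "\<And>x. x \<in> carrier A \<Longrightarrow> f x \<in> carrier B"
    and "\<And>x y. \<lbrakk>x \<in> carrier A; y \<in> carrier A\<rbrakk> \<Longrightarrow> f (x \<oplus>\<^bsub>A\<^esub> y) = f x \<oplus>\<^bsub>B\<^esub> f y"
    and "\<And>c x. \<lbrakk>c \<in> carrier k; x \<in> carrier A\<rbrakk> \<Longrightarrow> f (c \<odot>\<^bsub>A\<^esub> x) = c \<odot>\<^bsub>B\<^esub> f x"
    and "\<And>x y. \<lbrakk>x \<in> carrier A; y \<in> carrier A\<rbrakk> \<Longrightarrow> f (x \<stileturn>\<^bsub>A\<^esub> y) = f x \<stileturn>\<^bsub>B\<^esub> f y"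
    and "\<And>x y. \<lbrakk>x \<in> carrier A; y \<in> carrier A\<rbrakk> \<Longrightarrow> f (x \<turnstile>\<^bsub>A\<^esub> y) = f x \<turnstile>\<^bsub>B\<^esub> f y"
  shows "f \<in> diass_hom k A B"
  using assms by (auto simp: diass_hom_def module_hom_def)

lemma diass_hom_comp:
  assumes "f \<in> diass_hom k A B" "g \<in> diass_hom k B C"
  shows "(\<lambda>x. g (f x)) \<in> diass_hom k A C"
  by (rule diass_homI) (simp_all add: diass_homD[OF assms(1)] diass_homD[OF assms(2)])

lemma diass_hom_restrict:
  assumes "diassociative_algebra k A" "f \<in> diass_hom k A B"
  shows "restrict f (carrier A) \<in> diass_hom k A B"
proof -
  interpret diassociative_algebra k A by (rule assms(1))
  show ?thesis
    by (rule diass_homI) (simp_all add: diass_homD[OF assms(2)] lprod_closed rprod_closed)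
qed

lemma diassociative_algebraI:
  fixes A :: "('f, 'a, 'm) diass_scheme" (structure)
  assumes "field k" "\<zero> \<in> carrier A"
    and "\<And>x y. \<lbrakk>x \<in> carrier A; y \<in> carrier A\<rbrakk> \<Longrightarrow> x \<oplus> y \<in> carrier A"
    and "\<And>x. x \<in> carrier A \<Longrightarrow> \<exists>y\<in>carrier A. x \<oplus> y = \<zero>"
    and "\<And>c x. \<lbrakk>c \<in> carrier k; x \<in> carrier A\<rbrakk> \<Longrightarrow> c \<odot> x \<in> carrier A"
    and "\<And>x y. \<lbrakk>x \<in> carrier A; y \<in> carrier A\<rbrakk> \<Longrightarrow> x \<oplus> y = y \<oplus> x"
    and "\<And>x y z. \<lbrakk>x \<in> carrier A; y \<in> carrier A; z \<in> carrier A\<rbrakk> \<Longrightarrow> (x \<oplus> y) \<oplus> z = x \<oplus> (y \<oplus> z)"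
    and "\<And>x. x \<in> carrier A \<Longrightarrow> x \<oplus> \<zero> = x"
    and "\<And>c d x. \<lbrakk>c \<in> carrier k; d \<in> carrier k; x \<in> carrier A\<rbrakk> \<Longrightarrow> (c \<otimes>\<^bsub>k\<^esub> d) \<odot> x = c \<odot> (d \<odot> x)"
    and "\<And>x. x \<in> carrier A \<Longrightarrow> \<one>\<^bsub>k\<^esub> \<odot> x = x"
    and "\<And>c x y. \<lbrakk>c \<in> carrier k; x \<in> carrier A; y \<in> carrier A\<rbrakk> \<Longrightarrow> c \<odot> (x \<oplus> y) = c \<odot> x \<oplus> c \<odot> y"
    and "\<And>c d x. \<lbrakk>c \<in> carrier k; d \<in> carrier k; x \<in> carrier A\<rbrakk> \<Longrightarrow> (c \<oplus>\<^bsub>k\<^esub> d) \<odot> x = c \<odot> x \<oplus> d \<odot> x"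
    and "diassociative_algebra_axioms k A"
  shows "diassociative_algebra k A"
proof -
  interpret field k by fact
  have "abelian_group A"
  proof (rule abelian_groupI)
    fix x assume x: "x \<in> carrier A"
    then obtain y where y: "y \<in> carrier A" "x \<oplus> y = \<zero>" using assms(4) by blast
    then show "\<exists>y\<in>carrier A. y \<oplus> x = \<zero>" using assms(6)[OF x y(1)] by auto
    show "\<zero> \<oplus> x = x" using assms(6)[OF x assms(2)] assms(8)[OF x] by simp
  qed (fact assms)+
  then have "module k A"
    by (intro moduleI is_cring) (use assms(5,9-12) in auto)
  then show ?thesis
    using assms(1,13) by (simp add: diassociative_algebra_def vectorspace_def)
qed

context diassociative_algebra
begin

lemmas diass_closed = lprod_closed rprod_closed
lemmas diass_laws = lprod_add_left lprod_add_right rprod_add_left rprod_add_right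
  lprod_smult_left lprod_smult_right rprod_smult_left rprod_smult_right

lemma axioms_on_subset:
  assumes "S \<subseteq> carrier A" "\<And>x y. \<lbrakk>x \<in> S; y \<in> S\<rbrakk> \<Longrightarrow> x \<stileturn> y \<in> S \<and> x \<turnstile> y \<in> S"
  shows "diassociative_algebra_axioms k (A\<lparr>carrier := S\<rparr>)"
  using assms
  by unfold_locales
    (auto simp: subset_iff diass_laws lprod_assoc rprod_assoc diass_mid diass_right
      intro: diass_left)

lemma restricted_algebra:
  assumes "S \<subseteq> carrier A" "\<zero>\<^bsub>A\<^esub> \<in> S"
    and "\<And>x y. \<lbrakk>x \<in> S; y \<in> S\<rbrakk> \<Longrightarrow> x \<oplus>\<^bsub>A\<^esub> y \<in> S"
    and "\<And>c x. \<lbrakk>c \<in> carrier k; x \<in> S\<rbrakk> \<Longrightarrow> c \<odot>\<^bsub>A\<^esub> x \<in> S"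
    and "\<And>x y. \<lbrakk>x \<in> S; y \<in> S\<rbrakk> \<Longrightarrow> x \<stileturn> y \<in> S"
    and "\<And>x y. \<lbrakk>x \<in> S; y \<in> S\<rbrakk> \<Longrightarrow> x \<turnstile> y \<in> S"
  shows "diassociative_algebra k (A\<lparr>carrier := S\<rparr>)"
proof (rule diassociative_algebraI)
  show "diassociative_algebra_axioms k (A\<lparr>carrier := S\<rparr>)"
    using assms by (intro axioms_on_subset) auto
  fix x assume "x \<in> carrier (A\<lparr>carrier := S\<rparr>)"
  then have x: "x \<in> S" "x \<in> carrier A" using assms(1) by auto
  have "(\<ominus>\<^bsub>k\<^esub> \<one>\<^bsub>k\<^esub>) \<odot>\<^bsub>A\<^esub> x \<in> S" using assms(4) x by simp
  moreover have "x \<oplus>\<^bsub>A\<^esub> (\<ominus>\<^bsub>k\<^esub> \<one>\<^bsub>k\<^esub>) \<odot>\<^bsub>A\<^esub> x = \<zero>\<^bsub>A\<^esub>"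
    using x by (simp add: smult_minus_1 M.r_neg)
  ultimately show "\<exists>y\<in>carrier (A\<lparr>carrier := S\<rparr>). x \<oplus>\<^bsub>A\<lparr>carrier := S\<rparr>\<^esub> y = \<zero>\<^bsub>A\<lparr>carrier := S\<rparr>\<^esub>"
    by auto
qed (use assms field_axioms in \<open>auto simp: subset_iff M.add.m_ac smult_assoc1
      smult_l_distr smult_r_distr\<close>)

end

text \<open>Transport of structure along a map \<open>e\<close> that is injective on the carrier.\<close>

definition diass_transport :: "('a \<Rightarrow> 'b) \<Rightarrow> ('f, 'a, 'm) diass_scheme \<Rightarrow> ('f, 'b) diass"
  where "diass_transport e A = (let d = inv_into (carrier A) e in
    \<lparr>carrier = e ` carrier A, mult = undefined, one = undefined,
     zero = e \<zero>\<^bsub>A\<^esub>, add = (\<lambda>u v. e (d u \<oplus>\<^bsub>A\<^esub> d v)),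
     smult = (\<lambda>c u. e (c \<odot>\<^bsub>A\<^esub> d u)),
     lprod = (\<lambda>u v. e (d u \<stileturn>\<^bsub>A\<^esub> d v)),
     rprod = (\<lambda>u v. e (d u \<turnstile>\<^bsub>A\<^esub> d v))\<rparr>)"

lemma diass_transport:
  assumes "diassociative_algebra k A" "inj_on e (carrier A)"
  shows "diassociative_algebra k (diass_transport e A)"
    and "e \<in> diass_hom k A (diass_transport e A)"
    and "inv_into (carrier A) e \<in> diass_hom k (diass_transport e A) A"
proof -
  interpret diassociative_algebra k A by (rule assms(1))
  note [simp] = inv_into_f_f[OF assms(2)] diass_closed
  note T = diass_transport_def Let_def
  have "diassociative_algebra_axioms k (diass_transport e A)"
    by unfold_locales
      (auto simp: T diass_laws lprod_assoc rprod_assoc diass_mid diass_right diass_left[symmetric])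
  then show "diassociative_algebra k (diass_transport e A)"
  proof (rule diassociative_algebraI[rotated -1])
    fix u assume "u \<in> carrier (diass_transport e A)"
    then obtain x where x: "x \<in> carrier A" "u = e x" by (auto simp: T)
    then show "\<exists>v\<in>carrier (diass_transport e A).
        u \<oplus>\<^bsub>diass_transport e A\<^esub> v = \<zero>\<^bsub>diass_transport e A\<^esub>"
      by (intro bexI[of _ "e (\<ominus>\<^bsub>A\<^esub> x)"]) (auto simp: T M.r_neg)
  qed (auto simp: T field_axioms M.add.m_ac smult_assoc1 smult_l_distr smult_r_distr)
  show "e \<in> diass_hom k A (diass_transport e A)"
    "inv_into (carrier A) e \<in> diass_hom k (diass_transport e A) A"
    by (auto intro!: diass_homI simp: T)
qed

primrec diass_eval ::
  "('f, 'a, 'm) diass_scheme \<Rightarrow> ('x \<Rightarrow> 'a) \<Rightarrow> ('f, 'x) diass_term \<Rightarrow> 'a" where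
  "diass_eval A g (Gen x) = g x"
| "diass_eval A g Zero = \<zero>\<^bsub>A\<^esub>"
| "diass_eval A g (Add s t) = diass_eval A g s \<oplus>\<^bsub>A\<^esub> diass_eval A g t"
| "diass_eval A g (Smult c t) = c \<odot>\<^bsub>A\<^esub> diass_eval A g t"
| "diass_eval A g (LProd s t) = diass_eval A g s \<stileturn>\<^bsub>A\<^esub> diass_eval A g t"
| "diass_eval A g (RProd s t) = diass_eval A g s \<turnstile>\<^bsub>A\<^esub> diass_eval A g t"

lemma free_diass_extend:
  fixes F :: "('f, 'a) diass" and A :: "('f, 'b, 'm) diass_scheme"
  assumes F: "free_diass_on k F X" and A: "diassociative_algebra k A" and g: "g \<in> X \<rightarrow> carrier A"
  shows "\<exists>h\<in>diass_hom k F A. \<forall>x\<in>X. h x = g x"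
proof -
  interpret A: diassociative_algebra k A by (rule A)
  define B where "B = carrier A \<inter> range (diass_eval A g)"
  define e where "e b = {t. diass_eval A g t = b}" for b
  have closed: "diass_eval A g s \<in> carrier A \<Longrightarrow> c \<odot>\<^bsub>A\<^esub> diass_eval A g s \<in> range (diass_eval A g)"
    "diass_eval A g s \<oplus>\<^bsub>A\<^esub> diass_eval A g t \<in> range (diass_eval A g)"
    "diass_eval A g s \<stileturn>\<^bsub>A\<^esub> diass_eval A g t \<in> range (diass_eval A g)"
    "diass_eval A g s \<turnstile>\<^bsub>A\<^esub> diass_eval A g t \<in> range (diass_eval A g)"
    "\<zero>\<^bsub>A\<^esub> \<in> range (diass_eval A g)" "g x \<in> range (diass_eval A g)" for s t c x
    by (metis diass_eval.simps rangeI)+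
  have B: "diassociative_algebra k (A\<lparr>carrier := B\<rparr>)"
    by (rule A.restricted_algebra) (auto simp: B_def A.diass_closed closed)
  have inj: "inj_on e (carrier (A\<lparr>carrier := B\<rparr>))"
    by (auto simp: inj_on_def e_def B_def)
  note T = diass_transport[OF B inj]
  have gB: "g x \<in> B" if "x \<in> X" for x
    using that g by (auto simp: B_def closed)
  have "(\<lambda>x. e (g x)) \<in> X \<rightarrow> carrier (diass_transport e (A\<lparr>carrier := B\<rparr>))"
    using gB by (auto simp: diass_transport_def Let_def)
  then have "\<exists>!h. h \<in> diass_hom k F (diass_transport e (A\<lparr>carrier := B\<rparr>)) \<inter> extensional (carrier F)
      \<and> (\<forall>x\<in>X. h x = e (g x))"
    using F T(1) unfolding free_diass_on_def by simp
  then obtain h where h: "h \<in> diass_hom k F (diass_transport e (A\<lparr>carrier := B\<rparr>))"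
      "\<forall>x\<in>X. h x = e (g x)"
    by blast
  have "(\<lambda>x. inv_into B e (h x)) \<in> diass_hom k F (A\<lparr>carrier := B\<rparr>)"
    using diass_hom_comp[OF h(1) T(3)] by simp
  then have "(\<lambda>x. inv_into B e (h x)) \<in> diass_hom k F A"
    by (auto simp: diass_hom_def module_hom_def B_def)
  moreover have "inv_into B e (h x) = g x" if "x \<in> X" for x
    using that h(2) gB inj by simp
  ultimately show ?thesis by (intro bexI[of _ "\<lambda>x. inv_into B e (h x)"] ballI)
qed

theorem free_diass_universal:
  fixes F :: "('f, 'a) diass" and A :: "('f, 'b, 'm) diass_scheme"
  assumes F: "free_diass_on k F X" and A: "diassociative_algebra k A" and g: "g \<in> X \<rightarrow> carrier A"
  shows "\<exists>!h. h \<in> diass_hom k F A \<inter> extensional (carrier F) \<and> (\<forall>x\<in>X. h x = g x)"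
proof -
  interpret A: diassociative_algebra k A by (rule A)
  have F': "diassociative_algebra k F" and X: "X \<subseteq> carrier F"
    using F by (auto simp: free_diass_on_def)
  interpret F: diassociative_algebra k F by (rule F')
  obtain h where h: "h \<in> diass_hom k F A" "\<forall>x\<in>X. h x = g x"
    using free_diass_extend[OF F A g] by blast
  show ?thesis
  proof (rule ex1I[of _ "restrict h (carrier F)"])
    show "restrict h (carrier F) \<in> diass_hom k F A \<inter> extensional (carrier F) \<and>
        (\<forall>x\<in>X. restrict h (carrier F) x = g x)"
      using diass_hom_restrict[OF F' h(1)] h(2) X by auto
    fix h' assume h': "h' \<in> diass_hom k F A \<inter> extensional (carrier F) \<and> (\<forall>x\<in>X. h' x = g x)"
    then have h'_hom: "h' \<in> diass_hom k F A" by blast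
    note h_simps = diass_homD[OF h(1)] diass_homD[OF h'_hom]
    define E where "E = {x \<in> carrier F. h x = h' x}"
    have zero: "f \<zero>\<^bsub>F\<^esub> = \<zero>\<^bsub>A\<^esub>" if "f \<in> diass_hom k F A" for f
    proof -
      have "f (\<zero>\<^bsub>k\<^esub> \<odot>\<^bsub>F\<^esub> \<zero>\<^bsub>F\<^esub>) = \<zero>\<^bsub>k\<^esub> \<odot>\<^bsub>A\<^esub> f \<zero>\<^bsub>F\<^esub>" by (rule diass_homD(3)[OF that]) auto
      then show ?thesis using diass_homD(1)[OF that] by simp
    qed
    have E: "diassociative_algebra k (F\<lparr>carrier := E\<rparr>)"
      by (rule F.restricted_algebra)
        (auto simp: E_def h_simps F.diass_closed zero[OF h(1)] zero[OF h'_hom])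
    have "(\<lambda>x. x) \<in> X \<rightarrow> carrier (F\<lparr>carrier := E\<rparr>)"
      using X h(2) h' by (auto simp: E_def)
    then obtain r where r: "r \<in> diass_hom k F (F\<lparr>carrier := E\<rparr>)" "\<forall>x\<in>X. r x = x"
      using free_diass_extend[OF F E] by blast
    have rE: "r x \<in> E" if "x \<in> carrier F" for x
      using diass_homD(1)[OF r(1) that] by simp
    have r': "r \<in> diass_hom k F F"
      using r(1) by (auto simp: diass_hom_def module_hom_def E_def)
    define e :: "'a \<Rightarrow> ('f, 'a) diass_term set" where "e x = {Gen x}" for x
    have "inj_on e (carrier F)" by (auto simp: inj_on_def e_def)
    note T = diass_transport[OF F' this]
    have "e \<in> X \<rightarrow> carrier (diass_transport e F)"
      using X by (auto simp: diass_transport_def Let_def)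
    then have "\<exists>!f. f \<in> diass_hom k F (diass_transport e F) \<inter> extensional (carrier F) \<and> (\<forall>x\<in>X. f x = e x)"
      using F T(1) unfolding free_diass_on_def by blast
    moreover have "restrict e (carrier F) \<in> diass_hom k F (diass_transport e F)"
      "restrict (\<lambda>x. e (r x)) (carrier F) \<in> diass_hom k F (diass_transport e F)"
      using diass_hom_restrict[OF F'] T(2) diass_hom_comp[OF r' T(2)] by auto
    ultimately have "restrict (\<lambda>x. e (r x)) (carrier F) = restrict e (carrier F)"
      using r(2) X by (elim ex1E) (smt (verit) IntI restrict_apply restrict_extensional subsetD)
    then have "r x = x" if "x \<in> carrier F" for x
      using that by (metis (no_types, lifting) e_def diass_term.inject(1) restrict_apply the_elem_eq)
    then have "h x = h' x" if "x \<in> carrier F" for x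
      using that rE[OF that] by (simp add: E_def)
    then show "h' = restrict h (carrier F)"
      using h' by (intro extensionalityI[of _ "carrier F"]) auto
  qed
qed

end

theory Submission
  imports Defs
begin

text \<open>Let \<open>R\<close> be the kernel of \<open>p : F \<rightarrow> L\<close> and put \<open>I = F \<diamond> R + R \<diamond> F\<close>, \<open>K = F' / I\<close>.
  Everything rests on one observation: a product in which a factor is changed by an element whose
  products all vanish does not change.

  Since \<open>L\<close> is perfect, \<open>p\<close> maps \<open>F'\<close> onto \<open>L' = L\<close>, so \<open>F = F' + R\<close> (\<open>perfect_split\<close>). Modulo
  \<open>I\<close> all products with elements of \<open>R\<close> vanish, so every product in \<open>F\<close> is congruent to a
  product of elements of \<open>F'\<close>: the algebra \<open>K\<close> is itself perfect (\<open>K_perfect\<close>). Hence the kernel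
  \<open>M\<close> of the induced surjection \<open>K \<rightarrow> L\<close> lies in \<open>K' = K\<close>. It is central
  because it consists of classes of elements of \<open>R\<close>, so \<open>(K, M)\<close> is a defining pair.

  Now let \<open>(E, N)\<close> be any defining pair, with projection \<open>\<pi> : E \<rightarrow> L\<close>. Freeness lifts \<open>p\<close> to
  \<open>h : F \<rightarrow> E\<close> with \<open>\<pi> h = p\<close>. It sends \<open>R\<close> into the central subspace \<open>N\<close> and therefore kills \<open>I\<close>.
  Moreover \<open>E = h(F) + N\<close>, and since \<open>N\<close> is central this gives \<open>E' = h(F')\<close>. As \<open>N \<subseteq> E'\<close> and \<open>L\<close> is
  perfect, \<open>E = E' + N = E'\<close>, so \<open>h\<close> maps \<open>F'\<close> onto \<open>E\<close> (\<open>central_extension_covered\<close>). Hence \<open>E\<close>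
  is a homomorphic image of \<open>K\<close>, which bounds its dimension (\<open>K_dominates\<close>). The algebra \<open>K\<close> thus
  surjects onto every defining pair, and dimensions may be compared as cardinals through a
  basis of \<open>K\<close> (\<open>dim_le_of_surj\<close>).\<close>

section \<open>Bases and surjective linear maps\<close>

context vectorspace
begin

lemma subspaceI:
  assumes "W \<subseteq> carrier V" "\<zero>\<^bsub>V\<^esub> \<in> W"
    and "\<And>v w. \<lbrakk>v \<in> W; w \<in> W\<rbrakk> \<Longrightarrow> v \<oplus>\<^bsub>V\<^esub> w \<in> W"
    and "\<And>c v. \<lbrakk>c \<in> carrier K; v \<in> W\<rbrakk> \<Longrightarrow> c \<odot>\<^bsub>V\<^esub> v \<in> W"
  shows "VectorSpace.subspace K W V"
  unfolding VectorSpace.subspace_def LinearCombinations.submodule_def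
  using assms vectorspace_axioms module_axioms by auto

lemma subspaceD:
  assumes "VectorSpace.subspace K W V"
  shows "W \<subseteq> carrier V" "\<zero>\<^bsub>V\<^esub> \<in> W"
    and "\<lbrakk>v \<in> W; w \<in> W\<rbrakk> \<Longrightarrow> v \<oplus>\<^bsub>V\<^esub> w \<in> W"
    and "\<lbrakk>c \<in> carrier K; v \<in> W\<rbrakk> \<Longrightarrow> c \<odot>\<^bsub>V\<^esub> v \<in> W"
  using assms unfolding VectorSpace.subspace_def LinearCombinations.submodule_def by auto

lemma subspace_minus_closed:
  assumes W: "VectorSpace.subspace K W V" and "v \<in> W" "w \<in> W"
  shows "v \<ominus>\<^bsub>V\<^esub> w \<in> W"
proof -
  have "(\<ominus>\<^bsub>K\<^esub> \<one>\<^bsub>K\<^esub>) \<odot>\<^bsub>V\<^esub> w \<in> W" using subspaceD(4)[OF W] assms(3) by simp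
  then have "\<ominus>\<^bsub>V\<^esub> w \<in> W" using subspaceD(1)[OF W] assms(3) by (auto simp: smult_minus_1)
  then show ?thesis unfolding a_minus_def using subspaceD(3)[OF W] assms(2) by blast
qed

lemma minus_add_cancel:
  assumes "v \<in> carrier V" "w \<in> carrier V"
  shows "w \<oplus>\<^bsub>V\<^esub> (v \<ominus>\<^bsub>V\<^esub> w) = v"
proof -
  have "w \<oplus>\<^bsub>V\<^esub> (v \<oplus>\<^bsub>V\<^esub> \<ominus>\<^bsub>V\<^esub> w) = v \<oplus>\<^bsub>V\<^esub> (w \<oplus>\<^bsub>V\<^esub> \<ominus>\<^bsub>V\<^esub> w)"
    using assms by (intro M.a_lcomm) auto
  then show ?thesis using assms by (simp add: M.minus_eq M.r_neg)
qed

lemma minus_eq_zero_iff: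
  assumes "v \<in> carrier V" "w \<in> carrier V"
  shows "v \<ominus>\<^bsub>V\<^esub> w = \<zero>\<^bsub>V\<^esub> \<longleftrightarrow> v = w"
  using minus_add_cancel[OF assms] assms by (auto simp: M.minus_eq M.r_neg)

lemma span_least:
  assumes "VectorSpace.subspace K W V" "S \<subseteq> W"
  shows "span S \<subseteq> W"
  using span_is_subset[OF assms(2)] assms(1) unfolding VectorSpace.subspace_def by blast

lemma set_add_subspace:
  assumes W: "VectorSpace.subspace K W1 V" "VectorSpace.subspace K W2 V"
  shows "VectorSpace.subspace K (W1 <+>\<^bsub>V\<^esub> W2) V"
    and "W1 \<subseteq> W1 <+>\<^bsub>V\<^esub> W2" "W2 \<subseteq> W1 <+>\<^bsub>V\<^esub> W2"
    and "\<lbrakk>VectorSpace.subspace K U V; W1 \<subseteq> U; W2 \<subseteq> U\<rbrakk> \<Longrightarrow> W1 <+>\<^bsub>V\<^esub> W2 \<subseteq> U"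
proof -
  have eq: "W1 <+>\<^bsub>V\<^esub> W2 = subspace_sum W1 W2"
    by (force simp: set_add_def' submodule_sum_def)
  show "VectorSpace.subspace K (W1 <+>\<^bsub>V\<^esub> W2) V"
    unfolding eq by (rule sum_is_subspace[OF W])
  show "W1 \<subseteq> W1 <+>\<^bsub>V\<^esub> W2" unfolding eq by (rule in_sum_vs[OF W])
  show "W2 \<subseteq> W1 <+>\<^bsub>V\<^esub> W2"
    unfolding eq vsum_comm[OF W] by (rule in_sum_vs[OF W(2,1)])
  show "W1 <+>\<^bsub>V\<^esub> W2 \<subseteq> U" if "VectorSpace.subspace K U V" "W1 \<subseteq> U" "W2 \<subseteq> U"
    unfolding eq using vsum_is_minimal[OF W that(1)] that(2,3) by blast
qed

text \<open>Zorn's lemma on the independent subsets of \<open>S\<close>. A linear dependence involves only finitely many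
  vectors, so independence passes to unions of chains; and a vector of \<open>S\<close> outside the span of a
  maximal independent subset could be added to it.\<close>

lemma generating_set_contains_basis:
  assumes S: "S \<subseteq> carrier V" and gen: "span S = carrier V"
  shows "\<exists>B\<subseteq>S. basis B"
proof -
  define \<A> where "\<A> = {B. B \<subseteq> S \<and> lin_indpt B}"
  have "\<exists>B\<in>\<A>. \<forall>X\<in>\<A>. B \<subseteq> X \<longrightarrow> X = B"
  proof (rule subset_Zorn_nonempty)
    have "{} \<in> \<A>" by (auto simp: \<A>_def lin_dep_def)
    then show "\<A> \<noteq> {}" by blast
    fix \<C> assume C: "\<C> \<noteq> {}" "subset.chain \<A> \<C>"
    then have sub: "\<C> \<subseteq> \<A>" by (simp add: subset.chain_def)
    have "lin_indpt (\<Union>\<C>)"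
    proof
      assume "lin_dep (\<Union>\<C>)"
      then obtain A a v where A: "finite A" "A \<subseteq> \<Union>\<C>" "a \<in> A \<rightarrow> carrier K"
          "lincomb a A = \<zero>\<^bsub>V\<^esub>" "v \<in> A" "a v \<noteq> \<zero>\<^bsub>K\<^esub>"
        unfolding lin_dep_def by blast
      obtain B where "B \<in> \<C>" "A \<subseteq> B"
        using finite_subset_Union_chain[OF A(1,2) C] by blast
      then show False using A sub unfolding lin_dep_def \<A>_def by blast
    qed
    then show "\<Union>\<C> \<in> \<A>" using sub by (auto simp: \<A>_def)
  qed
  then obtain B where B: "B \<subseteq> S" "lin_indpt B"
    and max: "\<And>X. \<lbrakk>X \<subseteq> S; lin_indpt X; B \<subseteq> X\<rbrakk> \<Longrightarrow> X = B"
    by (auto simp: \<A>_def)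
  have BV: "B \<subseteq> carrier V" using B(1) S by blast
  have "S \<subseteq> span B"
  proof
    fix v assume v: "v \<in> S"
    show "v \<in> span B"
    proof (cases "v \<in> B")
      case True
      then show ?thesis using in_own_span[OF BV] by blast
    next
      case False
      then have "lin_dep (B \<union> {v})" using max[of "B \<union> {v}"] v B(1) by blast
      then show ?thesis using lin_dep_iff_in_span[OF BV B(2) _ False] v S by blast
    qed
  qed
  then have "span S \<subseteq> span B" by (rule span_least[OF span_is_subspace[OF BV]])
  then have "span B = carrier V" using gen span_is_subset2[OF BV] by blast
  then show ?thesis using B BV unfolding basis_def by blast
qed

end

context linear_map
begin

lemma subspace_vimage:
  assumes "VectorSpace.subspace K U W"
  shows "VectorSpace.subspace K {x \<in> carrier V. T x \<in> U} V"
  by (rule V.subspaceI) (auto simp: W.subspaceD[OF assms])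

lemma subspace_image:
  assumes "VectorSpace.subspace K U V"
  shows "VectorSpace.subspace K (T ` U) W"
proof (rule W.subspaceI)
  note U = V.subspaceD[OF assms]
  show "T ` U \<subseteq> carrier W" using U(1) by auto
  show "\<zero>\<^bsub>W\<^esub> \<in> T ` U" using U(2) f0_is_0 by (metis imageI)
  show "u \<oplus>\<^bsub>W\<^esub> v \<in> T ` U" if "u \<in> T ` U" "v \<in> T ` U" for u v
    using that U(1,3) by (auto simp: subset_iff f_add[symmetric] simp del: f_add)
  show "c \<odot>\<^bsub>W\<^esub> v \<in> T ` U" if "c \<in> carrier K" "v \<in> T ` U" for c v
    using that U(1,4) by (auto simp: subset_iff f_smult[symmetric] simp del: f_smult)
qed

lemma image_span_subset:
  assumes "VectorSpace.subspace K U W" "S \<subseteq> carrier V" "T ` S \<subseteq> U"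
  shows "T ` V.module.span S \<subseteq> U"
  using V.span_least[OF subspace_vimage[OF assms(1)], of S] assms(2,3) by auto

text \<open>The image of a basis of the source generates the target and so contains a basis of it. Choosing
  preimages injects that basis into the basis of the source.\<close>

lemma dim_le_of_surj:
  assumes surj: "T ` carrier V = carrier W"
  shows "dim_le K W V"
proof -
  have "V.module.span (carrier V) = carrier V"
    using V.module.in_own_span[of "carrier V"] V.module.span_is_subset2[of "carrier V"] by blast
  then obtain C where C: "V.basis C"
    using V.generating_set_contains_basis[of "carrier V"] by blast
  then have CV: "C \<subseteq> carrier V" and CS: "V.module.span C = carrier V" by (auto simp: V.basis_def)
  have TC: "T ` C \<subseteq> carrier W" using CV by auto
  have "T ` V.module.span C \<subseteq> W.module.span (T ` C)"
    by (rule image_span_subset[OF W.span_is_subspace[OF TC] CV W.module.in_own_span[OF TC]])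
  then have "W.module.span (T ` C) = carrier W"
    using CS surj W.module.span_is_subset2[OF TC] by simp
  then obtain B where B: "B \<subseteq> T ` C" "W.basis B"
    using W.generating_set_contains_basis[OF TC] by blast
  have "B \<lesssim> C" using B(1) by (meson image_lepoll lepoll_trans subset_imp_lepoll)
  then show ?thesis unfolding dim_le_def using B(2) C by blast
qed

end

section \<open>Homomorphisms, quotients and factorisation\<close>

lemma diass_hom_linear_map:
  assumes "diassociative_algebra k A" "diassociative_algebra k B" "f \<in> diass_hom k A B"
  shows "linear_map k A B f"
proof -
  interpret A: diassociative_algebra k A by fact
  interpret B: diassociative_algebra k B by fact
  show ?thesis
    by unfold_locales (use assms(3) in \<open>simp add: diass_hom_def\<close>)
qed

text \<open>The axioms are equations, up to closure and the existence of negatives, so they are inherited by every structure that is the image of an algebra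
  under a map preserving the operations. Here \<open>B\<close> is not known to be a module, so the
  preservation of zero has to be assumed separately.\<close>

lemma diass_algebra_surj_image:
  fixes A :: "('f, 'a, 'm) diass_scheme" and B :: "('f, 'b, 'n) diass_scheme"
  assumes A: "diassociative_algebra k A" and f: "f \<in> diass_hom k A B"
    and surj: "carrier B = f ` carrier A" and zero: "\<zero>\<^bsub>B\<^esub> = f \<zero>\<^bsub>A\<^esub>"
  shows "diassociative_algebra k B"
proof -
  interpret A: diassociative_algebra k A by fact
  note [simp] = diass_homD(2-)[OF f, symmetric] A.diass_closed
  have "diassociative_algebra_axioms k B"
    by unfold_locales
      (auto simp: surj A.diass_laws A.lprod_assoc A.rprod_assoc A.diass_mid A.diass_right
        A.diass_left[symmetric])
  then show ?thesis
  proof (rule diassociative_algebraI[rotated -1])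
    fix u assume "u \<in> carrier B"
    then obtain x where x: "x \<in> carrier A" "u = f x" by (auto simp: surj)
    then show "\<exists>v\<in>carrier B. u \<oplus>\<^bsub>B\<^esub> v = \<zero>\<^bsub>B\<^esub>"
      by (intro bexI[of _ "f (\<ominus>\<^bsub>A\<^esub> x)"]) (auto simp: surj zero A.M.r_neg)
  qed (auto simp: surj zero A.field_axioms A.M.add.m_ac A.smult_assoc1 A.smult_l_distr
      A.smult_r_distr)
qed

text \<open>Elements with the same image under \<open>q\<close> differ by an element of its kernel, so \<open>f\<close> takes the same
  value on all preimages of a point and may be evaluated on an arbitrary one.\<close>

lemma diass_hom_factor:
  fixes A :: "('f, 'a, 'm) diass_scheme" and B :: "('f, 'b, 'n) diass_scheme"
    and C :: "('f, 'c, 'o) diass_scheme"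
  assumes A: "diassociative_algebra k A" and B: "diassociative_algebra k B"
    and C: "diassociative_algebra k C"
    and q: "q \<in> diass_hom k A B" and surj: "q ` carrier A = carrier B"
    and f: "f \<in> diass_hom k A C" and ker: "a_kernel A B q \<subseteq> a_kernel A C f"
  obtains g where "g \<in> diass_hom k B C" "\<And>x. x \<in> carrier A \<Longrightarrow> g (q x) = f x"
proof -
  interpret A: diassociative_algebra k A by fact
  interpret B: diassociative_algebra k B by fact
  interpret C: diassociative_algebra k C by fact
  interpret q: linear_map k A B q by (rule diass_hom_linear_map[OF A B q])
  interpret f: linear_map k A C f by (rule diass_hom_linear_map[OF A C f])
  define g where "g y = f (inv_into (carrier A) q y)" for y
  have g: "g (q x) = f x" if x: "x \<in> carrier A" for x
  proof -
    define x' where "x' = inv_into (carrier A) q (q x)"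
    have x': "x' \<in> carrier A" "q x' = q x"
      using x by (auto simp: x'_def inv_into_into f_inv_into_f)
    have "x' \<ominus>\<^bsub>A\<^esub> x \<in> a_kernel A B q"
      using x x' by (simp add: a_kernel_def' B.minus_eq_zero_iff)
    then have "f x' \<ominus>\<^bsub>C\<^esub> f x = \<zero>\<^bsub>C\<^esub>"
      using ker x x' by (auto simp: a_kernel_def')
    then have "f x' = f x" using x x' by (simp add: C.minus_eq_zero_iff)
    then show ?thesis by (simp add: g_def x'_def)
  qed
  have "g \<in> diass_hom k B C"
    by (rule diass_homI)
      (auto simp: surj[symmetric] diass_homD(2-)[OF q, symmetric] g A.diass_closed
        diass_homD[OF f] simp del: q.f_add q.f_smult)
  then show thesis using g that by blast
qed

definition diass_ideal :: "('f, 'r) ring_scheme \<Rightarrow> 'a set \<Rightarrow> ('f, 'a, 'm) diass_scheme \<Rightarrow> bool"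
  where "diass_ideal k I A \<longleftrightarrow> VectorSpace.subspace k I A \<and> (\<forall>x\<in>carrier A. \<forall>y\<in>I.
    x \<stileturn>\<^bsub>A\<^esub> y \<in> I \<and> y \<stileturn>\<^bsub>A\<^esub> x \<in> I \<and> x \<turnstile>\<^bsub>A\<^esub> y \<in> I \<and> y \<turnstile>\<^bsub>A\<^esub> x \<in> I)"

context diassociative_algebra
begin

lemma subspace_abelian_subgroup:
  assumes "VectorSpace.subspace k I A"
  shows "abelian_subgroup I A"
proof -
  note I = subspaceD[OF assms]
  have neg: "\<ominus>\<^bsub>A\<^esub> x \<in> I" if "x \<in> I" for x
    using subspace_minus_closed[OF assms I(2) that] that I(1)
    by (auto simp: M.minus_eq)
  have "subgroup I (add_monoid A)"
    by (rule M.add.subgroupI) (use I neg in \<open>auto simp: a_inv_def\<close>)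
  then show ?thesis
    by (intro abelian_subgroupI3 additive_subgroupI M.abelian_group_axioms)
qed

lemma prod_zero:
  assumes "x \<in> carrier A"
  shows "\<zero>\<^bsub>A\<^esub> \<stileturn> x = \<zero>\<^bsub>A\<^esub>" "x \<stileturn> \<zero>\<^bsub>A\<^esub> = \<zero>\<^bsub>A\<^esub>" "\<zero>\<^bsub>A\<^esub> \<turnstile> x = \<zero>\<^bsub>A\<^esub>" "x \<turnstile> \<zero>\<^bsub>A\<^esub> = \<zero>\<^bsub>A\<^esub>"
  using assms diass_laws(5-8)[of "\<zero>\<^bsub>k\<^esub>" "\<zero>\<^bsub>A\<^esub>" x] diass_laws(5-8)[of "\<zero>\<^bsub>k\<^esub>" x "\<zero>\<^bsub>A\<^esub>"]
  by (simp_all add: diass_closed)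

lemma quotient_map:
  assumes I: "diass_ideal k I A"
  shows "(\<lambda>x. I +>\<^bsub>A\<^esub> x) \<in> diass_hom k A (A /\<^sub>d I)"
    and "(\<lambda>x. I +>\<^bsub>A\<^esub> x) ` carrier A = carrier (A /\<^sub>d I)"
    and "diassociative_algebra k (A /\<^sub>d I)"
    and "a_kernel A (A /\<^sub>d I) (\<lambda>x. I +>\<^bsub>A\<^esub> x) = I"
proof -
  have sub: "VectorSpace.subspace k I A" using I by (simp add: diass_ideal_def)
  note S = subspaceD[OF sub]
  interpret I: abelian_subgroup I A by (rule subspace_abelian_subgroup[OF sub])
  let ?q = "\<lambda>x. I +>\<^bsub>A\<^esub> x"
  have mem: "y \<in> ?q x \<longleftrightarrow> (\<exists>i\<in>I. y = i \<oplus>\<^bsub>A\<^esub> x)" for x y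
    by (auto simp: a_r_coset_def')
  have self: "x \<in> ?q x" if "x \<in> carrier A" for x
    using I.a_rcos_self[OF that] .
  have shift: "?q (i \<oplus>\<^bsub>A\<^esub> x) = ?q x" if "i \<in> I" "x \<in> carrier A" for i x
    using I.a_repr_independence'[of "i \<oplus>\<^bsub>A\<^esub> x" x] that by (auto simp: mem)
  have UN_const: "(\<Union>z\<in>Z. h z) = c" if "a \<in> Z" "\<And>z. z \<in> Z \<Longrightarrow> h z = c"
    for Z :: "'a set" and h :: "'a \<Rightarrow> 'a set" and a c
    using that by blast
  (* Operations on cosets are unions over all representatives; each such union is over equal
     cosets, so it collapses to the value at one representative. *)
  have smult: "(\<Union>y\<in>?q x. ?q (c \<odot>\<^bsub>A\<^esub> y)) = ?q (c \<odot>\<^bsub>A\<^esub> x)"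
    if c: "c \<in> carrier k" and x: "x \<in> carrier A" for c x
  proof -
    have "?q (c \<odot>\<^bsub>A\<^esub> y) = ?q (c \<odot>\<^bsub>A\<^esub> x)" if "y \<in> ?q x" for y
      using that S(1) c x by (auto simp: mem smult_r_distr subset_iff shift S(4))
    then show ?thesis by (rule UN_const[OF self[OF x]])
  qed
  \<comment> \<open>\<open>(i + x)(j + y)\<close> differs from \<open>xy\<close> by elements of \<open>I A + A I\<close>\<close>
  have lp: "(\<Union>u\<in>?q x. \<Union>v\<in>?q y. ?q (u \<stileturn> v)) = ?q (x \<stileturn> y)"
    and rp: "(\<Union>u\<in>?q x. \<Union>v\<in>?q y. ?q (u \<turnstile> v)) = ?q (x \<turnstile> y)"
    if x: "x \<in> carrier A" and y: "y \<in> carrier A" for x y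
  proof -
    have "?q (u \<stileturn> v) = ?q (x \<stileturn> y) \<and> ?q (u \<turnstile> v) = ?q (x \<turnstile> y)"
      if u: "u \<in> ?q x" and v: "v \<in> ?q y" for u v
    proof -
      obtain i j where i: "i \<in> I" "u = i \<oplus>\<^bsub>A\<^esub> x" and j: "j \<in> I" "v = j \<oplus>\<^bsub>A\<^esub> y"
        using u v unfolding mem by blast
      have ij: "i \<in> carrier A" "j \<in> carrier A" using i j S(1) by auto
      have V: "v \<in> carrier A" using ij j y by simp
      have "u \<stileturn> v = i \<stileturn> v \<oplus>\<^bsub>A\<^esub> x \<stileturn> v" "u \<turnstile> v = i \<turnstile> v \<oplus>\<^bsub>A\<^esub> x \<turnstile> v"
        unfolding i(2) using ij V x by (simp_all add: diass_laws)
      moreover have "x \<stileturn> v = x \<stileturn> j \<oplus>\<^bsub>A\<^esub> x \<stileturn> y" "x \<turnstile> v = x \<turnstile> j \<oplus>\<^bsub>A\<^esub> x \<turnstile> y"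
        unfolding j(2) using ij x y by (simp_all add: diass_laws)
      ultimately have 1: "u \<stileturn> v = i \<stileturn> v \<oplus>\<^bsub>A\<^esub> (x \<stileturn> j \<oplus>\<^bsub>A\<^esub> x \<stileturn> y)"
        "u \<turnstile> v = i \<turnstile> v \<oplus>\<^bsub>A\<^esub> (x \<turnstile> j \<oplus>\<^bsub>A\<^esub> x \<turnstile> y)" by simp_all
      have 2: "i \<stileturn> v \<in> I" "x \<stileturn> j \<in> I" "i \<turnstile> v \<in> I" "x \<turnstile> j \<in> I"
        using I i(1) j(1) V x unfolding diass_ideal_def by auto
      show ?thesis using 2 S(1) x y ij by (simp add: 1 shift diass_closed)
    qed
    note rep = this
    have inner: "(\<Union>v\<in>?q y. ?q (u \<stileturn> v)) = ?q (x \<stileturn> y)" "(\<Union>v\<in>?q y. ?q (u \<turnstile> v)) = ?q (x \<turnstile> y)"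
      if "u \<in> ?q x" for u
      by (rule UN_const[OF self[OF y]], simp add: rep[OF that])+
    show "(\<Union>u\<in>?q x. \<Union>v\<in>?q y. ?q (u \<stileturn> v)) = ?q (x \<stileturn> y)"
      by (rule UN_const[OF self[OF x] inner(1)])
    show "(\<Union>u\<in>?q x. \<Union>v\<in>?q y. ?q (u \<turnstile> v)) = ?q (x \<turnstile> y)"
      by (rule UN_const[OF self[OF x] inner(2)])
  qed
  show hom: "?q \<in> diass_hom k A (A /\<^sub>d I)"
    by (rule diass_homI)
      (auto simp: diass_quotient_def A_RCOSETS_def' I.a_rcos_sum smult lp rp)
  show surj: "?q ` carrier A = carrier (A /\<^sub>d I)"
    by (auto simp: diass_quotient_def A_RCOSETS_def')
  have q0: "?q x = I \<longleftrightarrow> x \<in> I" if "x \<in> carrier A" for x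
    using self[OF that] I.a_rcos_const[of x] by auto
  show "diassociative_algebra k (A /\<^sub>d I)"
    by (rule diass_algebra_surj_image[OF diassociative_algebra_axioms hom surj[symmetric]])
      (use q0[of "\<zero>\<^bsub>A\<^esub>"] S(2) in \<open>simp add: diass_quotient_def\<close>)
  show "a_kernel A (A /\<^sub>d I) ?q = I"
    using q0 S(1) by (auto simp: a_kernel_def' diass_quotient_def)
qed

end

lemma diass_ideal_kernel:
  assumes A: "diassociative_algebra k A" and B: "diassociative_algebra k B"
    and f: "f \<in> diass_hom k A B"
  shows "diass_ideal k (a_kernel A B f) A"
proof -
  interpret A: diassociative_algebra k A by fact
  interpret B: diassociative_algebra k B by fact
  interpret f: linear_map k A B f by (rule diass_hom_linear_map[OF A B f])
  have "VectorSpace.subspace k (a_kernel A B f) A"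
    by (rule A.subspaceI) (auto simp: a_kernel_def')
  then show ?thesis
    by (auto simp: diass_ideal_def a_kernel_def' diass_homD[OF f] A.diass_closed B.prod_zero)
qed

lemma diass_first_isomorphism:
  assumes A: "diassociative_algebra k A" and B: "diassociative_algebra k B"
    and f: "f \<in> diass_hom k A B" and surj: "f ` carrier A = carrier B"
  shows "diass_isomorphic k (A /\<^sub>d a_kernel A B f) B"
proof -
  interpret A: diassociative_algebra k A by fact
  interpret B: diassociative_algebra k B by fact
  interpret f: linear_map k A B f by (rule diass_hom_linear_map[OF A B f])
  let ?M = "a_kernel A B f" and ?q = "\<lambda>x. a_kernel A B f +>\<^bsub>A\<^esub> x"
  note Q = A.quotient_map[OF diass_ideal_kernel[OF A B f]]
  interpret Q: diassociative_algebra k "A /\<^sub>d ?M" by (rule Q(3))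
  interpret q: linear_map k A "A /\<^sub>d ?M" ?q by (rule diass_hom_linear_map[OF A Q(3,1)])
  obtain g where g: "g \<in> diass_hom k (A /\<^sub>d ?M) B" "\<And>x. x \<in> carrier A \<Longrightarrow> g (?q x) = f x"
    using diass_hom_factor[OF A Q(3) B Q(1,2) f] Q(4) by auto
  have "inj_on g (carrier (A /\<^sub>d ?M))"
  proof (rule inj_onI)
    fix u v assume uv: "u \<in> carrier (A /\<^sub>d ?M)" "v \<in> carrier (A /\<^sub>d ?M)" "g u = g v"
    from uv(1,2) obtain x y where xy: "x \<in> carrier A" "u = ?q x" "y \<in> carrier A" "v = ?q y"
      unfolding Q(2)[symmetric] by blast
    have "f x = f y" using uv(3) g(2)[OF xy(1)] g(2)[OF xy(3)] xy(2,4) by simp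
    then have "x \<ominus>\<^bsub>A\<^esub> y \<in> ?M"
      using xy(1,3) by (simp add: a_kernel_def' B.minus_eq_zero_iff)
    then have "?q (x \<ominus>\<^bsub>A\<^esub> y) = \<zero>\<^bsub>A /\<^sub>d ?M\<^esub>"
      using Q(4) by (auto simp: a_kernel_def')
    then show "u = v" using xy by (simp add: Q.minus_eq_zero_iff)
  qed
  moreover have "g ` carrier (A /\<^sub>d ?M) = carrier B"
    unfolding Q(2)[symmetric] surj[symmetric] image_image using g(2) by auto
  ultimately show ?thesis
    unfolding diass_isomorphic_def bij_betw_def using g(1) by blast
qed

section \<open>Spans of products\<close>

context diassociative_algebra
begin

lemma diamond_subspace:
  assumes "S \<subseteq> carrier A" "T \<subseteq> carrier A"
  shows "VectorSpace.subspace k (diamond k A S T) A"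
  unfolding diamond_def by (rule span_is_subspace) (use assms in \<open>auto simp: diass_closed subset_iff\<close>)

lemma diamond_mem:
  assumes "S \<subseteq> carrier A" "T \<subseteq> carrier A" "s \<in> S" "t \<in> T"
  shows "s \<stileturn> t \<in> diamond k A S T" "s \<turnstile> t \<in> diamond k A S T"
proof -
  have "{s \<stileturn> t |s t. s \<in> S \<and> t \<in> T} \<union> {s \<turnstile> t |s t. s \<in> S \<and> t \<in> T} \<subseteq> carrier A"
    using assms(1,2) by (auto simp: diass_closed subset_iff)
  from in_own_span[OF this] show "s \<stileturn> t \<in> diamond k A S T" "s \<turnstile> t \<in> diamond k A S T"
    unfolding diamond_def using assms(3,4) by blast+
qed

lemma diamond_least:
  assumes "VectorSpace.subspace k U A"
    and "\<And>s t. \<lbrakk>s \<in> S; t \<in> T\<rbrakk> \<Longrightarrow> s \<stileturn> t \<in> U \<and> s \<turnstile> t \<in> U"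
  shows "diamond k A S T \<subseteq> U"
  unfolding diamond_def by (rule span_least[OF assms(1)]) (use assms(2) in auto)

lemmas derived_subspace = diamond_subspace[OF subset_refl subset_refl, folded derived_def]
lemmas derived_mem = diamond_mem[OF subset_refl subset_refl, folded derived_def]
lemmas derived_carrier = subspaceD(1)[OF derived_subspace]

text \<open>If \<open>A = S + R\<close>, expanding \<open>(s + r)(t + r')\<close> shows that only the products of elements of \<open>S\<close> matter
  modulo a subspace \<open>U\<close> containing the products with \<open>R\<close>. This is applied with \<open>R\<close> the kernel of a
  free presentation, and with \<open>R\<close> central, whose products are zero and so lie in every subspace.\<close>

lemma derived_modulo:
  assumes U: "VectorSpace.subspace k U A" and S: "S \<subseteq> carrier A" and R: "R \<subseteq> carrier A"
    and split: "\<And>x. x \<in> carrier A \<Longrightarrow> \<exists>s\<in>S. \<exists>r\<in>R. x = s \<oplus>\<^bsub>A\<^esub> r"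
    and R_prod: "\<And>x r. \<lbrakk>x \<in> carrier A; r \<in> R\<rbrakk> \<Longrightarrow>
      x \<stileturn> r \<in> U \<and> r \<stileturn> x \<in> U \<and> x \<turnstile> r \<in> U \<and> r \<turnstile> x \<in> U"
    and S_prod: "\<And>s t. \<lbrakk>s \<in> S; t \<in> S\<rbrakk> \<Longrightarrow> s \<stileturn> t \<in> U \<and> s \<turnstile> t \<in> U"
  shows "derived k A \<subseteq> U"
  unfolding derived_def
proof (rule diamond_least[OF U])
  fix x y assume x: "x \<in> carrier A" and y: "y \<in> carrier A"
  obtain s r where s: "s \<in> S" "r \<in> R" "x = s \<oplus>\<^bsub>A\<^esub> r" using split[OF x] by blast
  obtain t r' where t: "t \<in> S" "r' \<in> R" "y = t \<oplus>\<^bsub>A\<^esub> r'" using split[OF y] by blast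
  have c: "s \<in> carrier A" "r \<in> carrier A" "t \<in> carrier A" "r' \<in> carrier A"
    using s t S R by auto
  have "x \<stileturn> y = s \<stileturn> y \<oplus>\<^bsub>A\<^esub> r \<stileturn> y" "x \<turnstile> y = s \<turnstile> y \<oplus>\<^bsub>A\<^esub> r \<turnstile> y"
    unfolding s(3) using c y by (simp_all add: diass_laws)
  moreover have "s \<stileturn> y = s \<stileturn> t \<oplus>\<^bsub>A\<^esub> s \<stileturn> r'" "s \<turnstile> y = s \<turnstile> t \<oplus>\<^bsub>A\<^esub> s \<turnstile> r'"
    unfolding t(3) using c by (simp_all add: diass_laws)
  ultimately have "x \<stileturn> y = (s \<stileturn> t \<oplus>\<^bsub>A\<^esub> s \<stileturn> r') \<oplus>\<^bsub>A\<^esub> r \<stileturn> y"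
    "x \<turnstile> y = (s \<turnstile> t \<oplus>\<^bsub>A\<^esub> s \<turnstile> r') \<oplus>\<^bsub>A\<^esub> r \<turnstile> y" by simp_all
  then show "x \<stileturn> y \<in> U \<and> x \<turnstile> y \<in> U"
    using R_prod[OF c(1) t(2)] R_prod[OF y s(2)] S_prod[OF s(1) t(1)]
    by (simp add: subspaceD(3)[OF U])
qed

lemma derived_subalgebra: "diassociative_algebra k (A\<lparr>carrier := derived k A\<rparr>)"
  by (rule restricted_algebra)
    (use derived_carrier derived_mem in \<open>auto simp: subspaceD[OF derived_subspace] subset_iff\<close>)

end

section \<open>Central extensions of a perfect algebra\<close>

text \<open>A surjection onto \<open>L = L'\<close> already maps the derived algebra onto \<open>L\<close>; the element \<open>r\<close> is the
  error made in replacing \<open>x\<close> by an element of the derived algebra with the same image.\<close>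

lemma perfect_split:
  assumes A: "diassociative_algebra k A" and L: "diassociative_algebra k L"
    and p: "p \<in> diass_hom k A L" and surj: "p ` carrier A = carrier L" and perf: "perfect k L"
    and x: "x \<in> carrier A"
  shows "\<exists>s\<in>derived k A. \<exists>r\<in>a_kernel A L p. x = s \<oplus>\<^bsub>A\<^esub> r"
proof -
  interpret A: diassociative_algebra k A by fact
  interpret L: diassociative_algebra k L by fact
  interpret p: linear_map k A L p by (rule diass_hom_linear_map[OF A L p])
  have "VectorSpace.subspace k (p ` derived k A) L"
    by (rule p.subspace_image[OF A.derived_subspace])
  then have "derived k L \<subseteq> p ` derived k A"
    unfolding derived_def[of k L]
    by (rule L.diamond_least)
      (auto simp: surj[symmetric] diass_homD(4,5)[OF p, symmetric] A.derived_mem)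
  then obtain s where s: "s \<in> derived k A" "p x = p s"
    using perf diass_homD(1)[OF p x] unfolding perfect_def by blast
  then have sA: "s \<in> carrier A" using A.derived_carrier by auto
  have "x \<ominus>\<^bsub>A\<^esub> s \<in> a_kernel A L p"
    using s(2) x sA by (simp add: a_kernel_def' L.minus_eq_zero_iff)
  moreover have "x = s \<oplus>\<^bsub>A\<^esub> (x \<ominus>\<^bsub>A\<^esub> s)"
    using x sA by (simp add: A.minus_add_cancel)
  ultimately show ?thesis using s(1) by blast
qed

text \<open>The algebra \<open>E\<close> is the sum of \<open>h ` carrier A\<close> and the central kernel \<open>N\<close> of \<open>\<pi>\<close>, so \<open>E'\<close> is spanned by
  products of elements of \<open>h ` carrier A\<close>, that is, \<open>E' \<subseteq> h(A')\<close>. Then \<open>N \<subseteq> E' \<subseteq> h(A')\<close>, and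
  \<open>E = E' + N\<close> because \<open>L\<close> is perfect.\<close>

lemma central_extension_covered:
  assumes A: "diassociative_algebra k A" and E: "diassociative_algebra k E"
    and L: "diassociative_algebra k L" and perf: "perfect k L"
    and h: "h \<in> diass_hom k A E" and \<pi>: "\<pi> \<in> diass_hom k E L"
    and surj: "(\<lambda>x. \<pi> (h x)) ` carrier A = carrier L"
    and ker: "a_kernel E L \<pi> \<subseteq> diass_center E \<inter> derived k E"
  shows "h ` derived k A = carrier E"
proof -
  interpret A: diassociative_algebra k A by fact
  interpret E: diassociative_algebra k E by fact
  interpret L: diassociative_algebra k L by fact
  interpret h: linear_map k A E h by (rule diass_hom_linear_map[OF A E h])
  interpret \<pi>: linear_map k E L \<pi> by (rule diass_hom_linear_map[OF E L \<pi>])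
  let ?N = "a_kernel E L \<pi>"
  have U: "VectorSpace.subspace k (h ` derived k A) E"
    by (rule h.subspace_image[OF A.derived_subspace])
  have NE: "?N \<subseteq> carrier E" by (auto simp: a_kernel_def')
  have "derived k E \<subseteq> h ` derived k A"
  proof (rule E.derived_modulo[OF U _ NE])
    show "h ` carrier A \<subseteq> carrier E" by auto
    show "\<exists>s\<in>h ` carrier A. \<exists>r\<in>?N. y = s \<oplus>\<^bsub>E\<^esub> r" if y: "y \<in> carrier E" for y
    proof -
      have "\<pi> y \<in> (\<lambda>x. \<pi> (h x)) ` carrier A"
        unfolding surj by (rule diass_homD(1)[OF \<pi> y])
      then obtain x where x: "x \<in> carrier A" "\<pi> y = \<pi> (h x)" by blast
      have hx: "h x \<in> carrier E" by (rule diass_homD(1)[OF h x(1)])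
      have "y \<ominus>\<^bsub>E\<^esub> h x \<in> ?N"
        using x(2) y hx by (simp add: a_kernel_def' L.minus_eq_zero_iff)
      then show ?thesis
        using E.minus_add_cancel[OF y hx, symmetric] x(1) by blast
    qed
    show "y \<stileturn>\<^bsub>E\<^esub> r \<in> h ` derived k A \<and> r \<stileturn>\<^bsub>E\<^esub> y \<in> h ` derived k A \<and>
        y \<turnstile>\<^bsub>E\<^esub> r \<in> h ` derived k A \<and> r \<turnstile>\<^bsub>E\<^esub> y \<in> h ` derived k A"
      if "y \<in> carrier E" "r \<in> ?N" for y r
    proof -
      have "r \<in> diass_center E" using ker that(2) by blast
      then show ?thesis using that(1) E.subspaceD(2)[OF U] by (simp add: diass_center_def)
    qed
    show "s \<stileturn>\<^bsub>E\<^esub> t \<in> h ` derived k A \<and> s \<turnstile>\<^bsub>E\<^esub> t \<in> h ` derived k A"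
      if "s \<in> h ` carrier A" "t \<in> h ` carrier A" for s t
      using that by (auto simp: diass_homD(4,5)[OF h, symmetric] A.derived_mem)
  qed
  then have sub: "derived k E \<subseteq> h ` derived k A" "?N \<subseteq> h ` derived k A"
    using ker by auto
  have \<pi>_surj: "\<pi> ` carrier E = carrier L"
    using surj diass_homD(1)[OF h] diass_homD(1)[OF \<pi>] by blast
  have "y \<in> h ` derived k A" if y: "y \<in> carrier E" for y
  proof -
    obtain s r where sr: "s \<in> derived k E" "r \<in> ?N" "y = s \<oplus>\<^bsub>E\<^esub> r"
      using perfect_split[OF E L \<pi> \<pi>_surj perf y] by blast
    then have "s \<in> h ` derived k A" "r \<in> h ` derived k A" using sub by blast+
    then show ?thesis unfolding sr(3) by (rule E.subspaceD(3)[OF U])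
  qed
  then show ?thesis using E.subspaceD(1)[OF U] by blast
qed

text \<open>A defining pair records only an isomorphism between \<open>E / N\<close> and \<open>L\<close>; for lifting, the composite
  projection from \<open>E\<close> itself is wanted.\<close>

lemma defining_pair_extension:
  assumes L: "diassociative_algebra k L" and pair: "defining_pair k L E N"
  obtains \<pi> where "\<pi> \<in> diass_hom k E L" "\<pi> ` carrier E = carrier L" "a_kernel E L \<pi> = N"
proof -
  have E: "diassociative_algebra k E" using pair by (simp add: defining_pair_def)
  interpret E: diassociative_algebra k E by fact
  have N: "VectorSpace.subspace k N E" "N \<subseteq> diass_center E"
    using pair by (auto simp: defining_pair_def diass_subalgebra_def)
  have ideal: "diass_ideal k N E"
    using N E.subspaceD(2)[OF N(1)] by (auto simp: diass_ideal_def diass_center_def subset_iff)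
  note Q = E.quotient_map[OF ideal]
  let ?q = "\<lambda>x. N +>\<^bsub>E\<^esub> x"
  obtain \<phi> where \<phi>: "\<phi> \<in> diass_hom k (E /\<^sub>d N) L" "bij_betw \<phi> (carrier (E /\<^sub>d N)) (carrier L)"
    using pair unfolding defining_pair_def diass_isomorphic_def by blast
  interpret QA: diassociative_algebra k "E /\<^sub>d N" by (rule Q(3))
  interpret \<phi>: linear_map k "E /\<^sub>d N" L \<phi> by (rule diass_hom_linear_map[OF Q(3) L \<phi>(1)])
  have "\<phi> (?q x) = \<zero>\<^bsub>L\<^esub> \<longleftrightarrow> ?q x = \<zero>\<^bsub>E /\<^sub>d N\<^esub>" if "x \<in> carrier E" for x
    using inj_on_eq_iff[OF bij_betw_imp_inj_on[OF \<phi>(2)] diass_homD(1)[OF Q(1) that] QA.M.zero_closed]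
    by simp
  then have "a_kernel E L (\<lambda>x. \<phi> (?q x)) = a_kernel E (E /\<^sub>d N) ?q"
    unfolding a_kernel_def' by blast
  moreover have "(\<lambda>x. \<phi> (?q x)) ` carrier E = carrier L"
    using bij_betw_imp_surj_on[OF \<phi>(2)] unfolding Q(2)[symmetric] image_image .
  ultimately show thesis
    using that[OF diass_hom_comp[OF Q(1) \<phi>(1)]] Q(4) by simp
qed

text \<open>Choose preimages of \<open>p\<close> on the free generators and extend; \<open>\<pi> h\<close> and \<open>p\<close> agree on the generators,
  hence everywhere by uniqueness.\<close>

lemma free_diass_lift:
  fixes F :: "('f, 'a) diass" and E :: "('f, 'b, 'm) diass_scheme"
    and L :: "('f, 'l, 'n) diass_scheme"
  assumes F: "free_diass k F" and E: "diassociative_algebra k E" and L: "diassociative_algebra k L"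
    and p: "p \<in> diass_hom k F L" and \<pi>: "\<pi> \<in> diass_hom k E L" and surj: "\<pi> ` carrier E = carrier L"
  obtains h where "h \<in> diass_hom k F E" "\<And>x. x \<in> carrier F \<Longrightarrow> \<pi> (h x) = p x"
proof -
  obtain X where X: "free_diass_on k F X" using F by (auto simp: free_diass_def)
  then have FA: "diassociative_algebra k F" and XF: "X \<subseteq> carrier F"
    by (auto simp: free_diass_on_def)
  define g where "g x = inv_into (carrier E) \<pi> (p x)" for x
  have g: "g x \<in> carrier E" "\<pi> (g x) = p x" if "x \<in> X" for x
  proof -
    have "p x \<in> \<pi> ` carrier E" using diass_homD(1)[OF p] that XF surj by blast
    then show "g x \<in> carrier E" "\<pi> (g x) = p x"
      by (simp_all add: g_def inv_into_into f_inv_into_f)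
  qed
  obtain h where h: "h \<in> diass_hom k F E" "\<forall>x\<in>X. h x = g x"
    using free_diass_extend[OF X E, of g] g(1) by blast
  have "p \<in> X \<rightarrow> carrier L" using diass_homD(1)[OF p] XF by blast
  from free_diass_universal[OF X L this]
  have "restrict (\<lambda>x. \<pi> (h x)) (carrier F) = restrict p (carrier F)"
  proof (rule ex1E)
    fix f assume uniq: "\<forall>f'. f' \<in> diass_hom k F L \<inter> extensional (carrier F) \<and> (\<forall>x\<in>X. f' x = p x) \<longrightarrow> f' = f"
    have "\<forall>x\<in>X. restrict (\<lambda>x. \<pi> (h x)) (carrier F) x = p x"
      using h(2) g(2) XF by auto
    then have "restrict (\<lambda>x. \<pi> (h x)) (carrier F) = f"
      using uniq diass_hom_restrict[OF FA diass_hom_comp[OF h(1) \<pi>]] restrict_extensional by blast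
    moreover have "\<forall>x\<in>X. restrict p (carrier F) x = p x" using XF by auto
    then have "restrict p (carrier F) = f"
      using uniq diass_hom_restrict[OF FA p] restrict_extensional by blast
    ultimately show ?thesis by simp
  qed
  then have "\<pi> (h x) = p x" if "x \<in> carrier F" for x
    using that by (metis restrict_apply')
  with h(1) show thesis by (rule that)
qed

section \<open>The cover of a perfect algebra\<close>

locale perfect_presentation =
  F: diassociative_algebra k F + L: diassociative_algebra k L
  for k :: "('f, 'r) ring_scheme" and F :: "('f, 'a) diass" and L :: "('f, 'l) diass" +
  fixes p :: "'a \<Rightarrow> 'l"
  assumes p: "p \<in> diass_hom k F L" and surj: "p ` carrier F = carrier L"
    and perf: "perfect k L"
begin

abbreviation R :: "'a set" where "R \<equiv> a_kernel F L p"
abbreviation I :: "'a set"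
  where "I \<equiv> diamond k F (carrier F) R <+>\<^bsub>F\<^esub> diamond k F R (carrier F)"
abbreviation G :: "('f, 'a) diass" where "G \<equiv> F\<lparr>carrier := derived k F\<rparr>"
abbreviation K :: "('f, 'a set) diass" where "K \<equiv> G /\<^sub>d I"
abbreviation q :: "'a \<Rightarrow> 'a set" where "q x \<equiv> I +>\<^bsub>G\<^esub> x"

lemma F_alg: "diassociative_algebra k F" and L_alg: "diassociative_algebra k L"
  by unfold_locales

lemma R_ideal: "diass_ideal k R F"
  by (rule diass_ideal_kernel[OF F_alg L_alg p])

lemma R_carrier: "R \<subseteq> carrier F"
  by (auto simp: a_kernel_def')

lemmas I_sum = F.set_add_subspace[OF F.diamond_subspace[OF subset_refl R_carrier]
    F.diamond_subspace[OF R_carrier subset_refl]]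

lemma I_prod:
  assumes "x \<in> carrier F" "r \<in> R"
  shows "x \<stileturn>\<^bsub>F\<^esub> r \<in> I" "r \<stileturn>\<^bsub>F\<^esub> x \<in> I" "x \<turnstile>\<^bsub>F\<^esub> r \<in> I" "r \<turnstile>\<^bsub>F\<^esub> x \<in> I"
  using F.diamond_mem[OF subset_refl R_carrier assms] F.diamond_mem[OF R_carrier subset_refl assms(2,1)]
    I_sum(2,3) by blast+

lemma I_least:
  assumes "VectorSpace.subspace k U F"
    and "\<And>x r. \<lbrakk>x \<in> carrier F; r \<in> R\<rbrakk> \<Longrightarrow>
      x \<stileturn>\<^bsub>F\<^esub> r \<in> U \<and> r \<stileturn>\<^bsub>F\<^esub> x \<in> U \<and> x \<turnstile>\<^bsub>F\<^esub> r \<in> U \<and> r \<turnstile>\<^bsub>F\<^esub> x \<in> U"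
  shows "I \<subseteq> U"
proof (rule I_sum(4)[OF assms(1)])
  show "diamond k F (carrier F) R \<subseteq> U"
    by (rule F.diamond_least[OF assms(1)]) (use assms(2) in blast)
  show "diamond k F R (carrier F) \<subseteq> U"
    by (rule F.diamond_least[OF assms(1)]) (use assms(2) in blast)
qed

lemma I_subset_R: "I \<subseteq> R"
  by (rule I_least) (use R_ideal in \<open>auto simp: diass_ideal_def\<close>)

lemma I_subset_derived: "I \<subseteq> derived k F"
  by (rule I_least[OF F.derived_subspace]) (use F.derived_mem R_carrier in blast)

lemma G_alg: "diassociative_algebra k G"
  by (rule F.derived_subalgebra)

text \<open>As \<open>I\<close> lies in \<open>R\<close>, its products with elements of \<open>F\<close> are among
  the generators of \<open>I\<close>.\<close>

lemma I_ideal: "diass_ideal k I G"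
proof -
  interpret G: diassociative_algebra k G by (rule G_alg)
  have "VectorSpace.subspace k I G"
    by (rule G.subspaceI) (use I_subset_derived in \<open>simp_all add: F.subspaceD[OF I_sum(1)]\<close>)
  then show ?thesis
    using I_prod I_subset_R F.derived_carrier by (auto simp: diass_ideal_def subset_iff)
qed

lemma quotient_I:
  shows q: "q \<in> diass_hom k G K" and q_surj: "q ` derived k F = carrier K"
    and K_alg: "diassociative_algebra k K" and q_kernel: "a_kernel G K q = I"
  using diassociative_algebra.quotient_map[OF G_alg I_ideal] by simp_all

text \<open>\<open>U\<close> collects the elements of \<open>F'\<close> whose class lies in \<open>K'\<close>. It contains \<open>I\<close>, in particular all
  products with elements of \<open>R\<close>, and products of elements of \<open>F'\<close>; since \<open>F = F' + R\<close>, it contains all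
  products.\<close>

lemma K_perfect: "derived k K = carrier K"
proof -
  interpret K: diassociative_algebra k K by (rule K_alg)
  interpret G: diassociative_algebra k G by (rule G_alg)
  interpret q: linear_map k G K q by (rule diass_hom_linear_map[OF G_alg K_alg q])
  define U where "U = {x \<in> derived k F. q x \<in> derived k K}"
  have "VectorSpace.subspace k U G"
    using q.subspace_vimage[OF K.derived_subspace] by (simp add: U_def)
  note UG = G.subspaceD[OF this]
  have U: "VectorSpace.subspace k U F"
    by (rule F.subspaceI) (use UG F.derived_carrier in auto)
  have IU: "I \<subseteq> U"
  proof
    fix x assume x: "x \<in> I"
    then have "q x = \<zero>\<^bsub>K\<^esub>" using q_kernel by (auto simp: a_kernel_def')
    then show "x \<in> U"
      using x I_subset_derived K.subspaceD(2)[OF K.derived_subspace] by (auto simp: U_def)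
  qed
  have "derived k F \<subseteq> U"
  proof (rule F.derived_modulo[OF U F.derived_carrier R_carrier])
    show "\<exists>s\<in>derived k F. \<exists>r\<in>R. x = s \<oplus>\<^bsub>F\<^esub> r" if "x \<in> carrier F" for x
      by (rule perfect_split[OF F_alg L_alg p surj perf that])
    show "x \<stileturn>\<^bsub>F\<^esub> r \<in> U \<and> r \<stileturn>\<^bsub>F\<^esub> x \<in> U \<and> x \<turnstile>\<^bsub>F\<^esub> r \<in> U \<and> r \<turnstile>\<^bsub>F\<^esub> x \<in> U"
      if "x \<in> carrier F" "r \<in> R" for x r
      using I_prod[OF that] IU by blast
    show "s \<stileturn>\<^bsub>F\<^esub> t \<in> U \<and> s \<turnstile>\<^bsub>F\<^esub> t \<in> U" if st: "s \<in> derived k F" "t \<in> derived k F" for s t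
    proof -
      have "s \<in> carrier F" "t \<in> carrier F" using st F.derived_carrier by auto
      moreover have "q s \<in> carrier K" "q t \<in> carrier K" using st q_surj by auto
      ultimately show ?thesis
        using diass_homD(4,5)[OF q, of s t] st K.derived_mem F.derived_mem by (simp add: U_def)
    qed
  qed
  then have "carrier K \<subseteq> derived k K" unfolding q_surj[symmetric] U_def by blast
  then show ?thesis using K.derived_carrier by blast
qed

lemma p_G: "p \<in> diass_hom k G L"
  using p F.derived_carrier by (auto simp: diass_hom_def module_hom_def subset_iff)

lemma p_derived: "p ` derived k F = carrier L"
proof -
  have "\<exists>s\<in>derived k F. p s = p x" if x: "x \<in> carrier F" for x
  proof -
    obtain s r where sr: "s \<in> derived k F" "r \<in> R" "x = s \<oplus>\<^bsub>F\<^esub> r"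
      using perfect_split[OF F_alg L_alg p surj perf x] by blast
    have sF: "s \<in> carrier F" using sr(1) F.derived_carrier by blast
    have "p x = p s \<oplus>\<^bsub>L\<^esub> p r"
      unfolding sr(3) using sr(2) sF R_carrier by (intro diass_homD(2)[OF p]) auto
    then have "p x = p s"
      using sr(2) diass_homD(1)[OF p sF] by (simp add: a_kernel_def')
    then show ?thesis using sr(1) by auto
  qed
  then have "carrier L \<subseteq> p ` derived k F" unfolding surj[symmetric] by (intro image_subsetI) (metis imageI)
  then show ?thesis using diass_homD(1)[OF p_G] by auto
qed

text \<open>The map \<open>r : K \<rightarrow> L\<close> is induced by \<open>p\<close>, and \<open>M\<close> is its kernel. A class in \<open>M\<close> is represented by an
  element of \<open>R\<close>, whose products with \<open>F\<close> lie in \<open>I\<close>, so it is central; that \<open>M \<subseteq> K'\<close> is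
  perfectness of \<open>K\<close>.\<close>

lemma K_defining_pair: "\<exists>M. defining_pair k L K M"
proof -
  interpret K: diassociative_algebra k K by (rule K_alg)
  have "a_kernel G K q \<subseteq> a_kernel G L p"
    unfolding q_kernel using I_subset_R I_subset_derived by (auto simp: a_kernel_def')
  moreover have "q ` carrier G = carrier K" using q_surj by simp
  ultimately obtain r where r: "r \<in> diass_hom k K L" "\<And>x. x \<in> carrier G \<Longrightarrow> r (q x) = p x"
    using diass_hom_factor[OF G_alg K_alg L_alg q _ p_G] by metis
  define M where "M = a_kernel K L r"
  have r_surj: "r ` carrier K = carrier L"
    unfolding q_surj[symmetric] p_derived[symmetric] image_image using r(2) by simp
  have MK: "M \<subseteq> carrier K" by (auto simp: M_def a_kernel_def')
  have ideal: "diass_ideal k M K"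
    unfolding M_def by (rule diass_ideal_kernel[OF K_alg L_alg r(1)])
  then have "diass_subalgebra k M K"
    using MK by (auto simp: diass_ideal_def diass_subalgebra_def)
  moreover have "M \<subseteq> diass_center K"
  proof
    fix z assume z: "z \<in> M"
    then obtain x where x: "x \<in> derived k F" "z = q x" using MK q_surj by blast
    then have "x \<in> R"
      using z r(2)[of x] F.derived_carrier by (auto simp: M_def a_kernel_def')
    note x_prod = I_prod[OF _ this]
    have I0: "q w = \<zero>\<^bsub>K\<^esub>" if "w \<in> I" for w
      using that q_kernel by (auto simp: a_kernel_def')
    have "z \<stileturn>\<^bsub>K\<^esub> u = \<zero>\<^bsub>K\<^esub> \<and> u \<stileturn>\<^bsub>K\<^esub> z = \<zero>\<^bsub>K\<^esub> \<and> z \<turnstile>\<^bsub>K\<^esub> u = \<zero>\<^bsub>K\<^esub> \<and> u \<turnstile>\<^bsub>K\<^esub> z = \<zero>\<^bsub>K\<^esub>"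
      if u: "u \<in> carrier K" for u
    proof -
      obtain y where y: "y \<in> derived k F" "u = q y" using u q_surj by blast
      have yF: "y \<in> carrier F" using y(1) F.derived_carrier by blast
      show ?thesis
        using diass_homD(4,5)[OF q, of x y] diass_homD(4,5)[OF q, of y x] x y(1)
          I0[OF x_prod(1)[OF yF]] I0[OF x_prod(2)[OF yF]]
          I0[OF x_prod(3)[OF yF]] I0[OF x_prod(4)[OF yF]]
        by (simp add: y(2))
    qed
    then show "z \<in> diass_center K" using z MK by (auto simp: diass_center_def)
  qed
  moreover have "diass_isomorphic k (K /\<^sub>d M) L"
    unfolding M_def by (rule diass_first_isomorphism[OF K_alg L_alg r(1) r_surj])
  ultimately have "defining_pair k L K M"
    using K_alg MK by (simp add: defining_pair_def K_perfect)
  then show ?thesis by blast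
qed

text \<open>A lift \<open>h : F \<rightarrow> E\<close> of \<open>p\<close> sends \<open>R\<close> into the central subspace \<open>N\<close>, so it vanishes on \<open>I\<close> and induces
  \<open>K \<rightarrow> E\<close>, which is onto since \<open>h\<close> is onto already on \<open>F'\<close>.\<close>

lemma K_dominates:
  fixes E :: "('f, 'b) diass"
  assumes free: "free_diass k F" and pair: "defining_pair k L E N"
  shows "dim_le k E K"
proof -
  have E: "diassociative_algebra k E" and N: "N \<subseteq> diass_center E \<inter> derived k E"
    using pair by (auto simp: defining_pair_def)
  interpret E: diassociative_algebra k E by (rule E)
  obtain \<pi> where \<pi>: "\<pi> \<in> diass_hom k E L" "\<pi> ` carrier E = carrier L" "a_kernel E L \<pi> = N"
    using defining_pair_extension[OF L_alg pair] by blast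
  obtain h where h: "h \<in> diass_hom k F E" "\<And>x. x \<in> carrier F \<Longrightarrow> \<pi> (h x) = p x"
    using free_diass_lift[OF free E L_alg p \<pi>(1,2)] by blast
  have "(\<lambda>x. \<pi> (h x)) ` carrier F = carrier L" using h(2) surj by simp
  then have h_surj: "h ` derived k F = carrier E"
    using central_extension_covered[OF F_alg E L_alg perf h(1) \<pi>(1)] \<pi>(3) N by blast
  have "I \<subseteq> a_kernel F E h"
  proof (rule I_least)
    show "VectorSpace.subspace k (a_kernel F E h) F"
      using diass_ideal_kernel[OF F_alg E h(1)] by (simp add: diass_ideal_def)
    fix x r assume x: "x \<in> carrier F" and r: "r \<in> R"
    have rF: "r \<in> carrier F" using r R_carrier by blast
    have "h r \<in> N"
      using h(2)[OF rF] r diass_homD(1)[OF h(1) rF] unfolding \<pi>(3)[symmetric] by (simp add: a_kernel_def')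
    then have "h r \<in> diass_center E" using N by blast
    then show "x \<stileturn>\<^bsub>F\<^esub> r \<in> a_kernel F E h \<and> r \<stileturn>\<^bsub>F\<^esub> x \<in> a_kernel F E h \<and>
        x \<turnstile>\<^bsub>F\<^esub> r \<in> a_kernel F E h \<and> r \<turnstile>\<^bsub>F\<^esub> x \<in> a_kernel F E h"
      using x rF diass_homD(1)[OF h(1) x]
      by (simp add: a_kernel_def' diass_center_def F.diass_closed diass_homD(4,5)[OF h(1)])
  qed
  then have "a_kernel G K q \<subseteq> a_kernel G E h"
    unfolding q_kernel using I_subset_derived by (auto simp: a_kernel_def')
  moreover have "h \<in> diass_hom k G E"
    using h(1) F.derived_carrier by (auto simp: diass_hom_def module_hom_def subset_iff)
  moreover have "q ` carrier G = carrier K" using q_surj by simp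
  ultimately obtain g where g: "g \<in> diass_hom k K E" "\<And>x. x \<in> carrier G \<Longrightarrow> g (q x) = h x"
    using diass_hom_factor[OF G_alg K_alg E q] by metis
  have "g ` carrier K = carrier E"
    unfolding q_surj[symmetric] h_surj[symmetric] image_image using g(2) by simp
  then show ?thesis
    by (rule linear_map.dim_le_of_surj[OF diass_hom_linear_map[OF K_alg E g(1)]])
qed

end

theorem theorem3p1:
  fixes k :: "('f, 'r) ring_scheme"
    and L :: "('f, 'l) diass"
    and F :: "('f, 'a) diass"
    and R :: "'a set"
    and p :: "'a \<Rightarrow> 'l"
  assumes "field k"
    and "diassociative_algebra k L"
    and "vectorspace.fin_dim k L"
    and "perfect k L"
    and "free_presentation k R F p L"
  shows "diass_cover TYPE('b) k L
           (F\<lparr>carrier := derived k F\<rparr> /\<^sub>d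
             (diamond k F (carrier F) R <+>\<^bsub>F\<^esub> diamond k F R (carrier F)))"
proof -
  have free: "free_diass k F" and p: "p \<in> diass_hom k F L" "p ` carrier F = carrier L"
    and R: "R = a_kernel F L p"
    using assms(5) by (auto simp: free_presentation_def)
  then have "diassociative_algebra k F" by (auto simp: free_diass_def free_diass_on_def)
  then interpret P: perfect_presentation k F L p
    using assms(2,4) p by (simp add: perfect_presentation_def perfect_presentation_axioms_def)
  obtain M where "defining_pair k L P.K M" using P.K_defining_pair by blast
  then have "maximal_defining_pair TYPE('b) k L P.K M"
    using P.K_dominates[OF free] by (auto simp: maximal_defining_pair_def)
  then show ?thesis unfolding R diass_cover_def by blast
qed

end
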